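(* Let $f:\mathbb{R}^n\to\mathbb{R}\cup\{\infty\}$ be a proper closed function with $\inf f\ge 0$, and let $g:\mathbb{R}^n\to\mathbb{R}$ be a continuous nonnegative function that is continuously differentiable on an open set containing $\mathrm{dom}\,f$, with $\inf_{\mathrm{dom}\,f}g>0$. Assume that one of the following conditions holds: (i) $f$ is locally Lipschitz. (ii) $f=h+\delta_D$ for some continuously differentiable function $h$ and nonempty closed set $D$. (iii) $f=h+\delta_D$ for some locally Lipschitz function $h$ and nonempty closed set $D$, and $h$ and $D$ are regular at every point in $D$. Let $G(x):=\frac{f(x)}{g(x)}$ and let $\bar x$ be such that $0\in\partial G(\bar x)$. Define $$H_{\bar x}(x):=f(x)-\frac{f(\bar x)}{g(\bar x)}\,g(x).$$ Then $\bar x\in\mathrm{dom}\,\partial H_{\bar x}$. Moreover, if $H_{\bar x}$ satisfies the Kurdyka-Łojasiewicz (KL) property with exponent $\theta\in[0,1)$ at $\bar x$, then so does $G$ (i.e., $G$ satisfies the KL property with exponent $\theta$ at $\bar x$).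
   Context: An extended-real-valued function $h:\mathbb{R}^n\to(-\infty,\infty]$ is proper if $\mathrm{dom}\,h:=\{x: h(x)<\infty\}\ne\emptyset$, and closed if it is lower semicontinuous. $G$ takes the value $+\infty$ outside $\mathrm{dom}\,f$. $\delta_D$ is the indicator function of $D$ ($0$ on $D$, $\infty$ off $D$). For proper closed $h$ and $\bar x\in\mathrm{dom}\,h$, the regular subdifferential is $\widehat\partial h(\bar x)=\{v:\liminf_{x\to\bar x,x\ne\bar x}\frac{h(x)-h(\bar x)-\langle v,x-\bar x\rangle}{\|x-\bar x\|}\ge0\}$, and the limiting subdifferential is $\partial h(\bar x)=\{v:\exists\,x^t\to\bar x \text{ with } h(x^t)\to h(\bar x) \text{ and } v^t\in\widehat\partial h(x^t)\text{ with }v^t\to v\}$. Both are empty for $x\notin\mathrm{dom}\,h$; $\mathrm{dom}\,\partial h:=\{x:\partial h(x)\neq\emptyset\}$. For a nonempty closed set $C$ and $x\in C$: $N_C(x)=\partial\delta_C(x)$, $\widehat N_C(x)=\widehat\partial\delta_C(x)$. $C$ is regular at $x\in C$ if $N_C(x)=\widehat N_C(x)$. A proper closed function $h$ is regular at $x\in\mathrm{dom}\,h$ if its epigraph $\{(x,t)\in\mathbb{R}^n\times\mathbb{R}:h(x)\le t\}$ is regular at $(x,h(x))$. KL property with exponent: a proper closed function $h$ satisfies the KL property with exponent $\theta\in[0,1)$ at $\widehat x\in\mathrm{dom}\,\partial h$ if there are $a\in(0,\infty]$, $a_0>0$ and a neighborhood $U$ of $\widehat x$ such that, with $\varphi(\nu)=a_0\nu^{1-\theta}$,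 one has $\varphi'(h(x)-h(\widehat x))\,\mathrm{dist}(0,\partial h(x))\ge1$ for every $x\in U$ with $h(\widehat x)<h(x)<h(\widehat x)+a$ (with $\mathrm{dist}(0,\emptyset)=\infty$). *)

theory Defs
  imports "HOL-Analysis.Analysis"
begin

text \<open>
  Extended-real-valued functions are modelled with codomain \<open>ereal\<close>; the exclusion of the value
  minus infinity is part of \<open>proper_fun\<close>. Points live in a Euclidean space, so that the
  subdifferential is also available on products \<open>'a \<times> real\<close>, which carry the Euclidean inner
  product and norm; this is needed for epigraphs.
\<close>

definition edom :: "('a \<Rightarrow> ereal) \<Rightarrow> 'a set" where
  "edom h = {x. h x < \<infinity>}"

definition proper_fun :: "('a \<Rightarrow> ereal) \<Rightarrow> bool" where
  "proper_fun h \<longleftrightarrow> (\<forall>x. h x \<noteq> -\<infinity>) \<and> edom h \<noteq> {}"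

definition closed_fun :: "('a::euclidean_space \<Rightarrow> ereal) \<Rightarrow> bool" where
  "closed_fun h \<longleftrightarrow> (\<forall>x. h x \<le> Liminf (at x) h)"

definition indicator_fun :: "'a set \<Rightarrow> 'a \<Rightarrow> ereal" where
  "indicator_fun D x = (if x \<in> D then 0 else \<infinity>)"

text \<open>\<open>at x\<close> is the punctured neighbourhood filter, as in the lower limit over points distinct from \<open>x\<close>.\<close>

definition regular_subdiff :: "('a::euclidean_space \<Rightarrow> ereal) \<Rightarrow> 'a \<Rightarrow> 'a set" where
  "regular_subdiff h x =
     (if x \<in> edom h
      then {v. Liminf (at x)
                 (\<lambda>y. (h y - h x - ereal (v \<bullet> (y - x))) / ereal (norm (y - x))) \<ge> 0}
      else {})"

definition limiting_subdiff :: "('a::euclidean_space \<Rightarrow> ereal) \<Rightarrow> 'a \<Rightarrow> 'a set" where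
  "limiting_subdiff h x =
     (if x \<in> edom h
      then {v. \<exists>X V. X \<longlonglongrightarrow> x \<and> (\<lambda>t. h (X t)) \<longlonglongrightarrow> h x \<and>
                     (\<forall>t. V t \<in> regular_subdiff h (X t)) \<and> V \<longlonglongrightarrow> v}
      else {})"

definition dom_subdiff :: "('a::euclidean_space \<Rightarrow> ereal) \<Rightarrow> 'a set" where
  "dom_subdiff h = {x. limiting_subdiff h x \<noteq> {}}"

definition limiting_normal_cone :: "'a::euclidean_space set \<Rightarrow> 'a \<Rightarrow> 'a set" where
  "limiting_normal_cone C x = limiting_subdiff (indicator_fun C) x"

definition regular_normal_cone :: "'a::euclidean_space set \<Rightarrow> 'a \<Rightarrow> 'a set" where
  "regular_normal_cone C x = regular_subdiff (indicator_fun C) x"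

definition regular_set_at :: "'a::euclidean_space set \<Rightarrow> 'a \<Rightarrow> bool" where
  "regular_set_at C x \<longleftrightarrow> x \<in> C \<and> limiting_normal_cone C x = regular_normal_cone C x"

text \<open>The library's \<open>epigraph\<close> is for real-valued functions only.\<close>

definition ereal_epigraph :: "('a \<Rightarrow> ereal) \<Rightarrow> ('a \<times> real) set" where
  "ereal_epigraph h = {(x, t). h x \<le> ereal t}"

definition regular_fun_at :: "('a::euclidean_space \<Rightarrow> ereal) \<Rightarrow> 'a \<Rightarrow> bool" where
  "regular_fun_at h x \<longleftrightarrow>
     x \<in> edom h \<and> regular_set_at (ereal_epigraph h) (x, real_of_ereal (h x))"

definition locally_lipschitz :: "('a::euclidean_space \<Rightarrow> real) \<Rightarrow> bool" where
  "locally_lipschitz h \<longleftrightarrow> (\<forall>x. \<exists>e>0. \<exists>L. L-lipschitz_on (ball x e) h)"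

definition cont_diff_on :: "'a::euclidean_space set \<Rightarrow> ('a \<Rightarrow> real) \<Rightarrow> bool" where
  "cont_diff_on S h \<longleftrightarrow> (\<exists>D. continuous_on S D \<and> (\<forall>x\<in>S. GDERIV h x :> D x))"

text \<open>\<open>infdist 0 {} = 0\<close> in the library, whereas here the distance to the empty set is infinite.\<close>

definition edist0 :: "'a::euclidean_space set \<Rightarrow> ereal" where
  "edist0 S = (if S = {} then \<infinity> else ereal (infdist 0 S))"

definition KL_exponent :: "('a::euclidean_space \<Rightarrow> ereal) \<Rightarrow> 'a \<Rightarrow> real \<Rightarrow> bool" where
  "KL_exponent h xhat \<theta> \<longleftrightarrow>
     proper_fun h \<and> closed_fun h \<and> xhat \<in> dom_subdiff h \<and> 0 \<le> \<theta> \<and> \<theta> < 1 \<and>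
     (\<exists>(a::ereal) (a0::real) U. 0 < a \<and> 0 < a0 \<and> xhat \<in> interior U \<and>
        (\<forall>x\<in>U. h xhat < h x \<and> h x < h xhat + a \<longrightarrow>
           ereal (deriv (\<lambda>\<nu>. a0 * \<nu> powr (1 - \<theta>)) (real_of_ereal (h x - h xhat)))
             * edist0 (limiting_subdiff h x) \<ge> 1))"

definition frac_obj :: "('a \<Rightarrow> ereal) \<Rightarrow> ('a \<Rightarrow> real) \<Rightarrow> 'a \<Rightarrow> ereal" where
  "frac_obj f g x = (if x \<in> edom f then f x / ereal (g x) else \<infinity>)"

definition diff_obj :: "('a \<Rightarrow> ereal) \<Rightarrow> ('a \<Rightarrow> real) \<Rightarrow> 'a \<Rightarrow> 'a \<Rightarrow> ereal" where
  "diff_obj f g xbar x = f x - (f xbar / ereal (g xbar)) * ereal (g x)"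

end

theory Submission
  imports Defs
begin

text \<open>
  Write \<open>c = f xbar / g xbar = G xbar\<close>. Where \<open>f\<close> is finite, \<open>g\<close> is positive and the two
  objectives are linked by the identity \<open>H = g * (G - c)\<close>; elsewhere both are infinite. Since
  \<open>g\<close> is \<open>C\<^sup>1\<close> near the domain, the product rule sends every \<open>v \<in> \<partial>G(x)\<close> to
  \<open>g(x) v + (G(x) - c) \<nabla>g(x) \<in> \<partial>H(x)\<close>. At \<open>x = xbar\<close> and \<open>v = 0\<close> the image is \<open>0\<close>, so
  \<open>\<partial>H(xbar)\<close> is nonempty. The product rule (\<open>limiting_subdiff_scaled_shift\<close>) holds for
  nonsmooth and extended-valued \<open>G\<close> because multiplication by a positive differentiable function
  carries first-order lower bounds of \<open>G\<close> to first-order lower bounds of the product.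

  For the KL inequality put \<open>d = G(x) - c > 0\<close>, which near \<open>xbar\<close> is comparable to
  \<open>H(x) = g(x) d\<close>. The inequality for \<open>H\<close>, applied to the image of \<open>v\<close>, bounds
  \<open>(g(x) d) powr \<theta>\<close> by a constant times \<open>g(x) |v| + d |\<nabla>g(x)|\<close>. The
  last term is linear in \<open>d\<close>, hence negligible against \<open>d powr \<theta>\<close> as \<open>\<theta> < 1\<close>, and what
  remains is the inequality for \<open>G\<close> with the same exponent (\<open>KL_exponent_of_scaled_shift\<close>).
  Lower semicontinuity of \<open>G\<close> comes from \<open>k < G \<longleftrightarrow> k g < f\<close> for real \<open>k\<close>.
\<close>

section \<open>Regular subgradients as first-order lower bounds\<close>

text \<open>Clearing the denominator leaves a bound without extended division or subtraction, to which
  real estimates of \<open>h\<close> apply directly.\<close>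

lemma regular_subdiff_iff:
  fixes h :: "'a::euclidean_space \<Rightarrow> ereal"
  assumes x: "h x = ereal r" and ninf: "\<And>y. h y \<noteq> -\<infinity>"
  shows "v \<in> regular_subdiff h x \<longleftrightarrow>
    (\<forall>\<epsilon>>0. \<forall>\<^sub>F y in at x. ereal (r + v \<bullet> (y - x) - \<epsilon> * norm (y - x)) \<le> h y)"
proof -
  let ?q = "\<lambda>y. (h y - h x - ereal (v \<bullet> (y - x))) / ereal (norm (y - x))"
  have quot: "ereal k < ?q y \<longleftrightarrow> ereal (r + v \<bullet> (y - x) + k * norm (y - x)) < h y"
    if "y \<noteq> x" for k y
  proof (cases "h y")
    case (real s)
    then show ?thesis using that x by (simp add: pos_less_divide_eq algebra_simps)
  next
    case PInf
    then show ?thesis using that x by simp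
  qed (use ninf in simp)
  have "v \<in> regular_subdiff h x \<longleftrightarrow> (\<forall>l<0. \<forall>\<^sub>F y in at x. l < ?q y)"
    using x by (simp add: regular_subdiff_def edom_def le_Liminf_iff)
  also have "\<dots> \<longleftrightarrow> (\<forall>\<epsilon>>0. \<forall>\<^sub>F y in at x. ereal (- \<epsilon>) < ?q y)" (is "?A \<longleftrightarrow> ?B")
  proof
    assume ?A then show ?B by auto
  next
    assume B: ?B
    show ?A
    proof (intro allI impI)
      fix l :: ereal assume l: "l < 0"
      obtain k where k: "l < ereal k" "ereal k < 0"
        using ereal_dense2[OF l] by auto
      then have "\<forall>\<^sub>F y in at x. ereal k < ?q y" using B[rule_format, of "- k"] by auto
      then show "\<forall>\<^sub>F y in at x. l < ?q y"
        by (rule eventually_mono) (use k in \<open>auto intro: less_trans\<close>)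
    qed
  qed
  also have "\<dots> \<longleftrightarrow> (\<forall>\<epsilon>>0. \<forall>\<^sub>F y in at x. ereal (r + v \<bullet> (y - x) - \<epsilon> * norm (y - x)) < h y)"
    by (intro all_cong1 imp_cong refl eventually_cong[OF eventually_neq_at_within[of x]])
       (simp add: quot del: uminus_ereal.simps)
  also have "\<dots> \<longleftrightarrow> (\<forall>\<epsilon>>0. \<forall>\<^sub>F y in at x. ereal (r + v \<bullet> (y - x) - \<epsilon> * norm (y - x)) \<le> h y)"
    (is "?C \<longleftrightarrow> ?D")
  proof
    assume ?C then show ?D by (auto elim!: eventually_mono intro: less_imp_le)
  next
    assume D: ?D
    show ?C
    proof (intro allI impI)
      fix \<epsilon> :: real assume \<epsilon>: "0 < \<epsilon>"
      have "\<forall>\<^sub>F y in at x. ereal (r + v \<bullet> (y - x) - \<epsilon> / 2 * norm (y - x)) \<le> h y"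
        using D \<epsilon> half_gt_zero by blast
      then show "\<forall>\<^sub>F y in at x. ereal (r + v \<bullet> (y - x) - \<epsilon> * norm (y - x)) < h y"
        using eventually_neq_at_within[of x]
      proof eventually_elim
        case (elim y)
        have "\<epsilon> / 2 * norm (y - x) < \<epsilon> * norm (y - x)" using \<epsilon> elim by simp
        then have "ereal (r + v \<bullet> (y - x) - \<epsilon> * norm (y - x))
            < ereal (r + v \<bullet> (y - x) - \<epsilon> / 2 * norm (y - x))" by simp
        then show ?case using elim(1) by (rule less_le_trans)
      qed
    qed
  qed
  finally show ?thesis .
qed

section \<open>Product rule for subgradients\<close>

text \<open>The product \<open>p * (F - c)\<close>, with the value infinity prescribed off the domain of \<open>F\<close> because
  there \<open>p\<close> may vanish or be negative and the extended product would then not be infinity.\<close>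

definition scaled_shift :: "('a \<Rightarrow> real) \<Rightarrow> real \<Rightarrow> ('a \<Rightarrow> ereal) \<Rightarrow> 'a \<Rightarrow> ereal" where
  "scaled_shift p c F x = (if x \<in> edom F then ereal (p x * (real_of_ereal (F x) - c)) else \<infinity>)"

lemma edom_scaled_shift [simp]: "edom (scaled_shift p c F) = edom F"
  by (auto simp: scaled_shift_def edom_def)

lemma scaled_shift_eq:
  "F x = ereal r \<Longrightarrow> scaled_shift p c F x = ereal (p x * (r - c))"
  by (simp add: scaled_shift_def edom_def)

lemma GDERIV_imp_isCont: "GDERIV p x :> d \<Longrightarrow> isCont p x"
  unfolding gderiv_def by (rule has_derivative_continuous)

text \<open>Multiplying the lower bound on \<open>F y\<close> by \<open>p y > 0\<close> preserves it. Replacing \<open>p y\<close> by its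
  first-order expansion in the constant part, and by \<open>p x\<close> in the part that is already of
  first order, costs only \<open>o(norm (y - x))\<close>.\<close>

lemma regular_subdiff_scaled_shift:
  fixes F :: "'a::euclidean_space \<Rightarrow> ereal"
  assumes x: "F x = ereal r" and ninf: "\<And>y. F y \<noteq> -\<infinity>"
    and grad: "GDERIV p x :> d" and pos: "p x > 0"
    and v: "v \<in> regular_subdiff F x"
  shows "p x *\<^sub>R v + (r - c) *\<^sub>R d \<in> regular_subdiff (scaled_shift p c F) x"
proof -
  let ?H = "scaled_shift p c F" and ?w = "p x *\<^sub>R v + (r - c) *\<^sub>R d"
  have Hninf: "?H y \<noteq> -\<infinity>" for y by (simp add: scaled_shift_def)
  have cont: "(p \<longlongrightarrow> p x) (at x)"
    using GDERIV_imp_isCont[OF grad] by (simp add: isCont_def)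
  have "\<forall>\<^sub>F y in at x. ereal (p x * (r - c) + ?w \<bullet> (y - x) - \<epsilon> * norm (y - x)) \<le> ?H y"
    if \<epsilon>: "\<epsilon> > 0" for \<epsilon>
  proof -
    \<comment> \<open>The three summands of \<open>K\<close> collect the errors from the bound on \<open>F\<close>, the expansion
      of \<open>p\<close>, and the continuity of \<open>p\<close>, each of them a multiple of \<open>\<delta>\<close>.\<close>
    define K where "K = (p x + 1) + \<bar>r - c\<bar> + norm v"
    define \<delta> where "\<delta> = \<epsilon> / K"
    have K: "K > 0" using pos by (simp add: K_def add_pos_nonneg)
    have \<delta>: "\<delta> > 0" "\<delta> * K = \<epsilon>" using \<epsilon> K by (auto simp: \<delta>_def)
    have evF: "\<forall>\<^sub>F y in at x. ereal (r + v \<bullet> (y - x) - \<delta> * norm (y - x)) \<le> F y"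
      using v \<delta>(1) regular_subdiff_iff[of F x r v, OF x ninf] by blast
    have evd: "\<forall>\<^sub>F y in at x. norm (p y - p x - (y - x) \<bullet> d) \<le> \<delta> * norm (y - x)"
      using grad \<delta>(1) unfolding gderiv_def has_derivative_within_alt2 by blast
    have evpos: "\<forall>\<^sub>F y in at x. 0 < p y" using order_tendstoD(1)[OF cont pos] .
    have evone: "\<forall>\<^sub>F y in at x. p y < p x + 1" by (rule order_tendstoD(2)[OF cont]) simp
    have evc: "\<forall>\<^sub>F y in at x. dist (p y) (p x) < \<delta>" by (rule tendstoD[OF cont \<delta>(1)])
    from evF evd evpos evone evc show ?thesis
    proof eventually_elim
      case (elim y)
      show ?case
      proof (cases "F y")
        case (real s)
        let ?n = "norm (y - x)"
        have 1: "p y * (r + v \<bullet> (y - x) - \<delta> * ?n) \<le> p y * s"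
          using elim(1,3) real by (intro mult_left_mono) auto
        have 2: "\<bar>(r - c) * (p y - p x - d \<bullet> (y - x))\<bar> \<le> \<bar>r - c\<bar> * (\<delta> * ?n)"
          unfolding abs_mult using elim(2) by (intro mult_left_mono) (auto simp: inner_commute)
        have 3: "\<bar>(p y - p x) * (v \<bullet> (y - x))\<bar> \<le> \<delta> * (norm v * ?n)"
          unfolding abs_mult using elim(5) Cauchy_Schwarz_ineq2[of v "y - x"] \<delta>(1)
          by (intro mult_mono) (auto simp: dist_real_def)
        have 4: "p y * (\<delta> * ?n) \<le> (p x + 1) * (\<delta> * ?n)"
          using elim(4) \<delta>(1) by (intro mult_right_mono) auto
        have "\<epsilon> * ?n = (p x + 1) * (\<delta> * ?n) + \<bar>r - c\<bar> * (\<delta> * ?n) + \<delta> * (norm v * ?n)"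
          unfolding \<delta>(2)[symmetric] K_def by (simp add: algebra_simps)
        then have "p x * (r - c) + ?w \<bullet> (y - x) - \<epsilon> * ?n \<le> p y * (s - c)"
          using 1 2 3 4 by (simp add: algebra_simps inner_add_left)
        then show ?thesis using real by (simp add: scaled_shift_eq)
      next
        case PInf
        then show ?thesis by (simp add: scaled_shift_def edom_def)
      qed (use ninf in simp)
    qed
  qed
  then show ?thesis
    by (subst regular_subdiff_iff[of ?H x "p x * (r - c)"]) (auto simp: x scaled_shift_eq Hninf)
qed

text \<open>Continuity of the gradient \<open>D\<close> lets the product rule pass to limits of regular subgradients.\<close>

lemma limiting_subdiff_scaled_shift:
  fixes F :: "'a::euclidean_space \<Rightarrow> ereal"
  assumes x: "F x = ereal r" and ninf: "\<And>y. F y \<noteq> -\<infinity>"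
    and dom: "edom F \<subseteq> S" and pos: "\<And>y. y \<in> edom F \<Longrightarrow> p y > 0"
    and grad: "\<And>y. y \<in> S \<Longrightarrow> GDERIV p y :> D y" and D: "continuous_on S D"
    and v: "v \<in> limiting_subdiff F x"
  shows "p x *\<^sub>R v + (r - c) *\<^sub>R D x \<in> limiting_subdiff (scaled_shift p c F) x"
proof -
  have xdom: "x \<in> edom F" using x by (simp add: edom_def)
  obtain X V where X: "X \<longlonglongrightarrow> x" and FX: "(\<lambda>t. F (X t)) \<longlonglongrightarrow> F x"
    and V: "\<And>t. V t \<in> regular_subdiff F (X t)" and Vv: "V \<longlonglongrightarrow> v"
    using v xdom by (auto simp: limiting_subdiff_def)
  have Xdom: "X t \<in> edom F" for t
    using V[of t] by (auto simp: regular_subdiff_def split: if_splits)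
  define s where "s t = real_of_ereal (F (X t))" for t
  have s: "F (X t) = ereal (s t)" for t
    using Xdom[of t] ninf[of "X t"] by (cases "F (X t)") (auto simp: s_def edom_def)
  have slim: "s \<longlonglongrightarrow> r" using FX by (simp add: x s)
  have plim: "(\<lambda>t. p (X t)) \<longlonglongrightarrow> p x"
    using GDERIV_imp_isCont[OF grad] xdom dom X by (blast intro: isCont_tendsto_compose)
  have Dlim: "(\<lambda>t. D (X t)) \<longlonglongrightarrow> D x"
    by (rule continuous_on_tendsto_compose[OF D X]) (use xdom Xdom dom in \<open>auto intro!: always_eventually\<close>)
  let ?W = "\<lambda>t. p (X t) *\<^sub>R V t + (s t - c) *\<^sub>R D (X t)"
  have "?W t \<in> regular_subdiff (scaled_shift p c F) (X t)" for t
    using Xdom dom by (intro regular_subdiff_scaled_shift s ninf grad pos V) auto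
  moreover have "?W \<longlonglongrightarrow> p x *\<^sub>R v + (r - c) *\<^sub>R D x"
    by (intro tendsto_intros plim Vv slim Dlim)
  moreover have "(\<lambda>t. scaled_shift p c F (X t)) \<longlonglongrightarrow> scaled_shift p c F x"
    unfolding scaled_shift_eq[of F, OF s] scaled_shift_eq[of F, OF x]
    by (intro tendsto_intros plim slim)
  ultimately show ?thesis
    using X xdom unfolding limiting_subdiff_def edom_scaled_shift
    by (simp, intro exI[of _ X] exI[of _ ?W] conjI allI)
qed

section \<open>The KL property in terms of individual subgradients\<close>

lemma desingularized_edist0_ge_1_iff:
  assumes "a0 > 0" "\<theta> < 1" "r > 0"
  shows "ereal (deriv (\<lambda>\<nu>. a0 * \<nu> powr (1 - \<theta>)) r) * edist0 A \<ge> 1 \<longleftrightarrow>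
    (\<forall>v\<in>A. r powr \<theta> \<le> a0 * (1 - \<theta>) * norm v)"
proof -
  let ?k = "a0 * (1 - \<theta>)"
  have k: "?k > 0" using assms by simp
  have "((\<lambda>\<nu>. a0 * \<nu> powr (1 - \<theta>)) has_real_derivative ?k * r powr (- \<theta>)) (at r)"
    using assms by (auto intro!: derivative_eq_intros)
  then have der: "deriv (\<lambda>\<nu>. a0 * \<nu> powr (1 - \<theta>)) r = ?k / r powr \<theta>"
    by (simp add: DERIV_imp_deriv powr_minus divide_inverse)
  show ?thesis
  proof (cases "A = {}")
    case True
    then show ?thesis using k assms by (simp add: der edist0_def)
  next
    case False
    have "ereal (?k / r powr \<theta>) * edist0 A \<ge> 1 \<longleftrightarrow> r powr \<theta> / ?k \<le> infdist 0 A"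
      using False k assms(3) by (simp add: edist0_def field_simps)
    also have "\<dots> \<longleftrightarrow> (\<forall>v\<in>A. r powr \<theta> / ?k \<le> norm v)"
    proof
      assume *: "r powr \<theta> / ?k \<le> infdist 0 A"
      show "\<forall>v\<in>A. r powr \<theta> / ?k \<le> norm v"
        using * infdist_le[of _ A 0] by (fastforce intro: order_trans)
    next
      assume "\<forall>v\<in>A. r powr \<theta> / ?k \<le> norm v"
      then show "r powr \<theta> / ?k \<le> infdist 0 A"
        using False by (auto simp: infdist_notempty intro!: cINF_greatest)
    qed
    also have "\<dots> \<longleftrightarrow> (\<forall>v\<in>A. r powr \<theta> \<le> ?k * norm v)"
      using k by (simp add: pos_divide_le_eq mult.commute)
    finally show ?thesis by (simp add: der)
  qed
qed

text \<open>Quantifying over subgradients replaces the distance to the subdifferential, so that the empty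
  subdifferential needs no separate treatment. The factor \<open>1 - \<theta> > 0\<close> from the
  derivative is merged into the constant \<open>k\<close>.\<close>

lemma KL_exponent_iff:
  fixes h :: "'a::euclidean_space \<Rightarrow> ereal"
  assumes proper: "proper_fun h" and closed: "closed_fun h" and dom: "xhat \<in> dom_subdiff h"
    and \<theta>: "0 \<le> \<theta>" "\<theta> < 1" and xhat: "h xhat = ereal b"
  shows "KL_exponent h xhat \<theta> \<longleftrightarrow>
    (\<exists>a>0. \<exists>k>0. \<exists>e>0. \<forall>x\<in>ball xhat e. \<forall>r. h x = ereal r \<longrightarrow> b < r \<longrightarrow> r < b + a \<longrightarrow>
       (\<forall>v\<in>limiting_subdiff h x. (r - b) powr \<theta> \<le> k * norm v))" (is "_ \<longleftrightarrow> ?R")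
proof
  assume "KL_exponent h xhat \<theta>"
  then obtain a :: ereal and a0 U where a: "0 < a" "0 < a0" "xhat \<in> interior U"
    and KL: "\<And>x. x \<in> U \<Longrightarrow> h xhat < h x \<Longrightarrow> h x < h xhat + a \<Longrightarrow>
       ereal (deriv (\<lambda>\<nu>. a0 * \<nu> powr (1 - \<theta>)) (real_of_ereal (h x - h xhat)))
             * edist0 (limiting_subdiff h x) \<ge> 1"
    unfolding KL_exponent_def by blast
  obtain e where e: "e > 0" "ball xhat e \<subseteq> U" using a(3) by (auto simp: mem_interior)
  obtain a' where a': "0 < ereal a'" "ereal a' < a" using ereal_dense2[OF a(1)] by blast
  show ?R
  proof (intro exI conjI ballI allI impI)
    show "0 < a'" "0 < a0 * (1 - \<theta>)" "0 < e" using a' a \<theta> e by auto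
  next
    fix x r v assume x: "x \<in> ball xhat e" "h x = ereal r" "b < r" "r < b + a'"
      and v: "v \<in> limiting_subdiff h x"
    have "ereal r < ereal b + ereal a'" using x by simp
    also have "\<dots> \<le> ereal b + a" using a' by (intro add_left_mono) simp
    finally have "h x < h xhat + a" using x xhat by simp
    then have "ereal (deriv (\<lambda>\<nu>. a0 * \<nu> powr (1 - \<theta>)) (r - b))
             * edist0 (limiting_subdiff h x) \<ge> 1"
      using KL[of x] x xhat e by auto
    then show "(r - b) powr \<theta> \<le> a0 * (1 - \<theta>) * norm v"
      using v x a \<theta> by (simp add: desingularized_edist0_ge_1_iff)
  qed
next
  assume ?R
  then obtain a k e where pos: "a > 0" "k > 0" "e > 0"
    and R: "\<And>x r v. x \<in> ball xhat e \<Longrightarrow> h x = ereal r \<Longrightarrow> b < r \<Longrightarrow> r < b + a \<Longrightarrow>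
       v \<in> limiting_subdiff h x \<Longrightarrow> (r - b) powr \<theta> \<le> k * norm v"
    by blast
  have k: "k / (1 - \<theta>) > 0" using pos \<theta> by simp
  have "ereal (deriv (\<lambda>\<nu>. k / (1 - \<theta>) * \<nu> powr (1 - \<theta>)) (real_of_ereal (h x - h xhat)))
             * edist0 (limiting_subdiff h x) \<ge> 1"
    if x: "x \<in> ball xhat e" "h xhat < h x" "h x < h xhat + ereal a" for x
  proof -
    obtain r where r: "h x = ereal r" using x xhat by (cases "h x") auto
    then have "b < r" "r < b + a" using x xhat by auto
    then show ?thesis
      using desingularized_edist0_ge_1_iff[OF k \<theta>(2), of "r - b" "limiting_subdiff h x"]
        R[OF x(1) r] \<theta> by (simp add: r xhat)
  qed
  then show "KL_exponent h xhat \<theta>"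
    unfolding KL_exponent_def using proper closed dom \<theta> pos k
    by (intro conjI exI[of _ "ereal a"] exI[of _ "k / (1 - \<theta>)"] exI[of _ "ball xhat e"]) auto
qed

text \<open>Near \<open>xhat\<close> the factor \<open>p\<close> lies between positive constants \<open>m\<close> and \<open>M\<close> and its
  gradient is bounded by \<open>L\<close>. A subgradient \<open>v\<close> of \<open>F\<close> therefore yields one of the product
  whose norm is at most \<open>M * norm v + L * (F x - c)\<close>, and the second summand is absorbed
  because \<open>\<theta> < 1\<close>.\<close>

lemma KL_exponent_of_scaled_shift:
  fixes F :: "'a::euclidean_space \<Rightarrow> ereal"
  assumes proper: "proper_fun F" and closed: "closed_fun F" and domF: "xhat \<in> dom_subdiff F"
    and xhat: "F xhat = ereal c"
    and S: "open S" "edom F \<subseteq> S" and pos: "\<And>y. y \<in> edom F \<Longrightarrow> p y > 0"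
    and grad: "\<And>y. y \<in> S \<Longrightarrow> GDERIV p y :> D y" and D: "continuous_on S D"
    and KL: "KL_exponent (scaled_shift p c F) xhat \<theta>"
  shows "KL_exponent F xhat \<theta>"
proof -
  let ?H = "scaled_shift p c F"
  have ninf: "F y \<noteq> -\<infinity>" for y using proper by (simp add: proper_fun_def)
  have \<theta>: "0 \<le> \<theta>" "\<theta> < 1" and H: "proper_fun ?H" "closed_fun ?H" "xhat \<in> dom_subdiff ?H"
    using KL by (auto simp: KL_exponent_def)
  have Hhat: "?H xhat = ereal 0" using xhat by (simp add: scaled_shift_eq)
  obtain a k e where ake: "a > 0" "k > 0" "e > 0"
    and KLH: "\<And>x r v. x \<in> ball xhat e \<Longrightarrow> ?H x = ereal r \<Longrightarrow> 0 < r \<Longrightarrow> r < a \<Longrightarrow>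
       v \<in> limiting_subdiff ?H x \<Longrightarrow> r powr \<theta> \<le> k * norm v"
    using KL unfolding KL_exponent_iff[OF H \<theta> Hhat] by auto
  have xdom: "xhat \<in> edom F" using xhat by (simp add: edom_def)
  then have xS: "xhat \<in> S" using S by auto
  have pc: "(p \<longlongrightarrow> p xhat) (nhds xhat)"
    using GDERIV_imp_isCont[OF grad[OF xS]] by (simp add: isCont_def tendsto_at_iff_tendsto_nhds)
  have Dc: "((\<lambda>y. norm (D y)) \<longlongrightarrow> norm (D xhat)) (nhds xhat)"
    using D S(1) xS by (simp add: continuous_on_eq_continuous_at isCont_def
        tendsto_at_iff_tendsto_nhds tendsto_norm)
  define m where "m = p xhat / 2"
  define M where "M = p xhat + 1"
  define L where "L = norm (D xhat) + 1"
  have mML: "m > 0" "M > 0" "L > 0"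
    using pos[OF xdom] by (auto simp: m_def M_def L_def add_nonneg_pos)
  have "\<forall>\<^sub>F y in nhds xhat. m < p y \<and> p y < M \<and> norm (D y) < L"
    by (intro eventually_conj order_tendstoD(1)[OF pc] order_tendstoD(2)[OF pc]
        order_tendstoD(2)[OF Dc]) (use pos[OF xdom] in \<open>auto simp: m_def M_def L_def\<close>)
  then obtain e' where e': "e' > 0"
    and loc: "\<And>y. dist y xhat < e' \<Longrightarrow> m < p y \<and> p y < M \<and> norm (D y) < L"
    by (auto simp: eventually_nhds_metric)
  \<comment> \<open>The radius \<open>q\<close> makes \<open>k * L * d \<le> (m * d) powr \<theta> / 2\<close> for \<open>0 < d < q\<close>.\<close>
  define q where "q = (m powr \<theta> / (2 * k * L)) powr (1 / (1 - \<theta>))"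
  have q: "q > 0" using mML ake by (simp add: q_def)
  have absorb: "k * (L * d) \<le> (m * d) powr \<theta> / 2" if d: "0 < d" "d < q" for d
  proof -
    have "d powr (1 - \<theta>) \<le> q powr (1 - \<theta>)"
      using d \<theta> by (intro powr_mono2) auto
    also have "\<dots> = m powr \<theta> / (2 * k * L)"
      using \<theta> mML ake by (simp add: q_def powr_powr)
    finally have 1: "k * L * d powr (1 - \<theta>) \<le> m powr \<theta> / 2"
      using mML ake by (simp add: field_simps)
    have "k * (L * d) = k * L * d powr (1 - \<theta>) * d powr \<theta>"
      using d by (simp add: powr_add[symmetric])
    also have "\<dots> \<le> m powr \<theta> / 2 * d powr \<theta>"
      using 1 by (intro mult_right_mono) auto
    also have "\<dots> = (m * d) powr \<theta> / 2"
      using d mML by (simp add: powr_mult)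
    finally show ?thesis .
  qed
  define k' where "k' = 2 * k * M / m powr \<theta>"
  show ?thesis
    unfolding KL_exponent_iff[OF proper closed domF \<theta> xhat]
  proof (intro exI conjI ballI allI impI)
    show "0 < min q (a / M)" "0 < k'" "0 < min e e'"
      using q ake e' mML by (auto simp: k'_def)
  next
    fix x r v
    assume x: "x \<in> ball xhat (min e e')" "F x = ereal r" "c < r" "r < c + min q (a / M)"
      and v: "v \<in> limiting_subdiff F x"
    let ?d = "r - c"
    have px: "m < p x" "p x < M" "norm (D x) < L"
      using loc[of x] x(1) by (auto simp: dist_commute)
    have d: "0 < ?d" "?d < q" "?d < a / M" using x by auto
    let ?w = "p x *\<^sub>R v + ?d *\<^sub>R D x"
    have w: "?w \<in> limiting_subdiff ?H x"
      by (rule limiting_subdiff_scaled_shift[OF x(2) ninf S(2) pos grad D v])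
    have "p x * ?d \<le> M * ?d" using px d by (intro mult_right_mono) auto
    also have "\<dots> < a" using d mML by (simp add: field_simps)
    finally have Hx: "?H x = ereal (p x * ?d)" "0 < p x * ?d" "p x * ?d < a"
      using x(2) d px mML by (auto simp: scaled_shift_eq)
    have "norm ?w \<le> p x * norm v + ?d * norm (D x)"
      using norm_triangle_ineq[of "p x *\<^sub>R v" "?d *\<^sub>R D x"] px mML d by simp
    also have "\<dots> \<le> M * norm v + L * ?d"
      using px d by (intro add_mono mult_right_mono) (auto simp: mult.commute[of ?d])
    finally have nw: "norm ?w \<le> M * norm v + L * ?d" .
    have "(m * ?d) powr \<theta> \<le> (p x * ?d) powr \<theta>"
      using px d mML \<theta> by (intro powr_mono2 mult_right_mono) auto
    also have "\<dots> \<le> k * norm ?w" using KLH[OF _ Hx w] x(1) by simp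
    also have "\<dots> \<le> k * (M * norm v + L * ?d)" using nw ake by (intro mult_left_mono) auto
    also have "\<dots> \<le> k * M * norm v + (m * ?d) powr \<theta> / 2"
      using absorb[OF d(1,2)] by (simp add: algebra_simps)
    finally have "m powr \<theta> * ?d powr \<theta> \<le> 2 * k * M * norm v"
      using d mML by (simp add: powr_mult)
    then show "?d powr \<theta> \<le> k' * norm v"
      using mML by (simp add: k'_def pos_le_divide_eq mult.commute)
  qed
qed

section \<open>Lower semicontinuity of the quotient and the conclusion\<close>

lemma closed_fun_iff:
  "closed_fun h \<longleftrightarrow> (\<forall>x l. l < h x \<longrightarrow> (\<forall>\<^sub>F y in at x. l < h y))"
  by (auto simp: closed_fun_def le_Liminf_iff)

text \<open>The condition \<open>k < f y / g y\<close> is rewritten as \<open>k * g y < f y\<close>, which is stable under small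
  changes of \<open>y\<close> because \<open>f\<close> is lower semicontinuous and \<open>g\<close> continuous, and which makes sense
  also where \<open>g\<close> vanishes off the domain of \<open>f\<close>.\<close>

lemma closed_fun_frac_obj:
  fixes f :: "'a::euclidean_space \<Rightarrow> ereal"
  assumes closed: "closed_fun f" and ninf: "\<And>x. f x \<noteq> -\<infinity>"
    and cont: "continuous_on UNIV g" and pos: "\<And>x. x \<in> edom f \<Longrightarrow> g x > 0"
  shows "closed_fun (frac_obj f g)"
  unfolding closed_fun_iff
proof (intro allI impI)
  fix x l assume l: "l < frac_obj f g x"
  have less_iff: "ereal k < frac_obj f g y \<longleftrightarrow> ereal (k * g y) < f y" for k y
  proof (cases "f y")
    case (real s)
    then have "y \<in> edom f" by (simp add: edom_def)
    then show ?thesis using real pos[of y] by (simp add: frac_obj_def pos_less_divide_eq)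
  next
    case PInf
    then show ?thesis by (simp add: frac_obj_def edom_def)
  next
    case MInf
    then show ?thesis using ninf[of y] by simp
  qed
  have Gninf: "-\<infinity> < frac_obj f g y" for y
    using ninf[of y] pos[of y] by (cases "f y") (auto simp: frac_obj_def edom_def)
  show "\<forall>\<^sub>F y in at x. l < frac_obj f g y"
  proof (cases "l = -\<infinity>")
    case True
    then show ?thesis using Gninf by simp
  next
    case False
    then obtain k where k: "l = ereal k" using l by (cases l) auto
    obtain u where u: "ereal (k * g x) < ereal u" "ereal u < f x"
      using l less_iff[of k x] ereal_dense2[of "ereal (k * g x)" "f x"] k by auto
    have "((\<lambda>y. k * g y) \<longlongrightarrow> k * g x) (at x)"
      using cont by (intro tendsto_intros) (auto simp: continuous_on_def)
    then have "\<forall>\<^sub>F y in at x. k * g y < u" using u by (intro order_tendstoD(2)) auto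
    moreover have "\<forall>\<^sub>F y in at x. ereal u < f y"
      using closed u by (auto simp: closed_fun_iff)
    ultimately show ?thesis
    proof eventually_elim
      case (elim y)
      from elim(1) have "ereal (k * g y) < ereal u" by simp
      then show ?case unfolding k less_iff using elim(2) by (rule less_trans)
    qed
  qed
qed

theorem theorem4p2:
  fixes f :: "real ^ 'n \<Rightarrow> ereal"
    and g :: "real ^ 'n \<Rightarrow> real"
    and xbar :: "real ^ 'n"
  assumes f_proper: "proper_fun f"
    and f_closed: "closed_fun f"
    and f_nonneg: "(INF x. f x) \<ge> 0"
    and g_cont: "continuous_on UNIV g"
    and g_nonneg: "\<forall>x. g x \<ge> 0"
    and g_C1: "\<exists>S. open S \<and> edom f \<subseteq> S \<and> cont_diff_on S g"
    and g_inf: "(INF x\<in>edom f. g x) > 0"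
    and f_cases:
      "(\<exists>h. locally_lipschitz h \<and> f = (\<lambda>x. ereal (h x))) \<or>
       (\<exists>h D. cont_diff_on UNIV h \<and> closed D \<and> D \<noteq> {} \<and>
              f = (\<lambda>x. ereal (h x) + indicator_fun D x)) \<or>
       (\<exists>h D. locally_lipschitz h \<and> closed D \<and> D \<noteq> {} \<and>
              f = (\<lambda>x. ereal (h x) + indicator_fun D x) \<and>
              (\<forall>x\<in>D. regular_fun_at (\<lambda>y. ereal (h y)) x \<and> regular_set_at D x))"
    and xbar_stat: "0 \<in> limiting_subdiff (frac_obj f g) xbar"
  shows "xbar \<in> dom_subdiff (diff_obj f g xbar) \<and>
         (\<forall>\<theta>\<in>{0..<1}. KL_exponent (diff_obj f g xbar) xbar \<theta> \<longrightarrow>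
                       KL_exponent (frac_obj f g) xbar \<theta>)"
proof -
  have fninf: "f x \<noteq> -\<infinity>" for x using f_proper by (simp add: proper_fun_def)
  have gpos: "g x > 0" if "x \<in> edom f" for x
  proof -
    have "(INF x\<in>edom f. g x) \<le> g x"
      using that g_nonneg by (intro cINF_lower bdd_belowI2[of _ 0]) auto
    then show ?thesis using g_inf by simp
  qed
  let ?G = "frac_obj f g"
  have G: "?G x = ereal (r / g x)" if "f x = ereal r" for x r
    using that gpos[of x] by (simp add: frac_obj_def edom_def)
  have Ginf: "?G x = \<infinity>" if "f x = \<infinity>" for x
    using that by (simp add: frac_obj_def edom_def)
  have fcases: "(\<exists>r. f x = ereal r) \<or> f x = \<infinity>" for x using fninf[of x] by (cases "f x") auto
  have edomG: "edom ?G = edom f"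
  proof (rule set_eqI)
    fix x show "x \<in> edom ?G \<longleftrightarrow> x \<in> edom f"
      using fcases[of x] G[of x] Ginf[of x] by (auto simp: edom_def)
  qed
  have Gproper: "proper_fun ?G"
    unfolding proper_fun_def edomG
  proof (intro conjI allI)
    show "?G x \<noteq> -\<infinity>" for x using fcases[of x] G[of x] Ginf[of x] by auto
    show "edom f \<noteq> {}" using f_proper by (simp add: proper_fun_def)
  qed
  have Gclosed: "closed_fun ?G" by (rule closed_fun_frac_obj[OF f_closed fninf g_cont gpos])
  have "xbar \<in> edom ?G" using xbar_stat by (auto simp: limiting_subdiff_def split: if_splits)
  then obtain b where b: "f xbar = ereal b" using fcases[of xbar] unfolding edomG by (auto simp: edom_def)
  define c where "c = b / g xbar"
  have gx: "g xbar > 0" using b by (intro gpos) (simp add: edom_def)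
  have Gx: "?G xbar = ereal c" using G[OF b] by (simp add: c_def)
  have H: "diff_obj f g xbar = scaled_shift g c ?G"
  proof
    fix x
    have fr: "f xbar / ereal (g xbar) = ereal c" using b gx by (simp add: c_def)
    show "diff_obj f g xbar x = scaled_shift g c ?G x"
    proof (cases "f x = \<infinity>")
      case True
      then show ?thesis by (simp add: diff_obj_def fr scaled_shift_def edom_def Ginf)
    next
      case False
      then obtain r where r: "f x = ereal r" using fcases by auto
      then have "g x > 0" by (intro gpos) (simp add: edom_def)
      then show ?thesis unfolding scaled_shift_eq[of ?G x, OF G[OF r]]
        by (simp add: diff_obj_def fr r field_simps)
    qed
  qed
  obtain S D where S: "open S" "edom ?G \<subseteq> S" and D: "continuous_on S D"
    and grad: "\<And>y. y \<in> S \<Longrightarrow> GDERIV g y :> D y"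
    using g_C1 by (auto simp: cont_diff_on_def edomG)
  have Gpos: "g y > 0" if "y \<in> edom ?G" for y using that gpos by (simp add: edomG)
  have ninf: "?G y \<noteq> -\<infinity>" for y using Gproper by (simp add: proper_fun_def)
  have "g xbar *\<^sub>R 0 + (c - c) *\<^sub>R D xbar \<in> limiting_subdiff (diff_obj f g xbar) xbar"
    unfolding H by (rule limiting_subdiff_scaled_shift[OF Gx ninf S(2) Gpos grad D xbar_stat])
  then have "xbar \<in> dom_subdiff (diff_obj f g xbar)" by (auto simp: dom_subdiff_def)
  moreover have "xbar \<in> dom_subdiff ?G" using xbar_stat by (auto simp: dom_subdiff_def)
  then have "KL_exponent ?G xbar \<theta>" if "KL_exponent (diff_obj f g xbar) xbar \<theta>" for \<theta>
    using KL_exponent_of_scaled_shift[OF Gproper Gclosed _ Gx S Gpos grad D] that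
    unfolding H by blast
  ultimately show ?thesis by blast
qed

end
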